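(* Suppose $d=1$. Let $\varphi:\mathbb{R}^2\to\mathbb{R}$ be final-time data, and let $u^\varepsilon(t,m,\xi,\eta)$ be the scaled value function defined by the dynamic programming principle (see context) with $u^\varepsilon(T,m,\xi,\eta)=\varphi(\xi,\eta)$. Let $$C_1^\#=\frac{(q(1)-r(1))^2+(q(0)-r(0))^2}{2},$$ and let $u(t,\xi,\eta)$ be a solution of $$u_t+\tfrac12 C_1^\#\Big\langle D^2u\,\frac{\nabla^\perp u}{u_\eta},\frac{\nabla^\perp u}{u_\eta}\Big\rangle=0\ \ (t<T),\qquad u(T,\xi,\eta)=\varphi(\xi,\eta).$$ Assume that $u$ satisfies: (i) $u$ has continuous, uniformly bounded derivatives in $(\xi,\eta)$ of order up to $4$; $u_t$ has continuous, uniformly bounded derivatives in $(\xi,\eta)$ of order up to $2$; and $u_{tt}$ is continuous and uniformly bounded, all bounds being uniform as $t\uparrow T$; (ii) $u_\eta>c>0$ for some constant $c$ uniform in space and time; (iii) $|u_\xi|\le u_\eta$. Then there is a constant $C$ (independent of $\varepsilon$, $t$, and $T$) such that $$u^\varepsilon(t,m,\xi,\eta)\ge u(t,\xi,\eta)-C\,[(T-t)+\varepsilon]\,\varepsilon\qquad\text{for } t<T,\ \xi\in\mathbb{R},\ \eta\in\mathbb{R},\ m\in\{0,1\},$$ whenever $\varepsilon>0$ is small enough and $t$ is such that $N=(T-t)/\varepsilon^2$ is an integer.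
   Context: The states are $m\in\{0,1\}$; for $b=\pm1$ the next state is $m_b=1$ if $b=1$ and $m_b=0$ if $b=-1$. Two experts are given by functions $q,r:\{0,1\}\to\mathbb{R}$ with $|q(m)|<1$ and $|r(m)|<1$ for all $m$, and $q(m)\ne r(m)$ for at least one $m$. For $\varepsilon>0$, $u^\varepsilon(t,m,\xi,\eta)$ is defined for times $t\le T$ with $(T-t)/\varepsilon^2$ a nonnegative integer, $m\in\{0,1\}$, $(\xi,\eta)\in\mathbb{R}^2$, by $u^\varepsilon(T,m,\xi,\eta)=\varphi(\xi,\eta)$ and, working backward in time, $$u^\varepsilon(t,m,\xi,\eta)=\min_{|f|\le1}\max_{b=\pm1}u^\varepsilon\big(t+\varepsilon^2,\,m_b,\,\xi+\varepsilon b[q(m)-r(m)],\,\eta+\varepsilon b[q(m)+r(m)-2f]\big).$$ Notation: $\nabla^\perp u=(-u_\eta,u_\xi)$ and $D^2u$ is the Hessian of $u$ in $(\xi,\eta)$. *)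

theory Defs
  imports "HOL-Analysis.Analysis"
begin

text \<open>
  States are the naturals \<open>0\<close> and \<open>1\<close>; expert predictions \<open>q\<close>, \<open>r\<close> are only ever evaluated there.
\<close>

definition next_state :: "real \<Rightarrow> nat" where
  "next_state b = (if b = 1 then 1 else 0)"

text \<open>
  The value function with \<open>n\<close> time steps remaining. The minimum over \<open>f\<close> is written as an infimum;
  for continuous final data it is attained (see \<open>u_eps_dpp\<close> below).
\<close>

primrec dpp_value ::
  "(nat \<Rightarrow> real) \<Rightarrow> (nat \<Rightarrow> real) \<Rightarrow> (real \<Rightarrow> real \<Rightarrow> real) \<Rightarrow> real
    \<Rightarrow> nat \<Rightarrow> nat \<Rightarrow> real \<Rightarrow> real \<Rightarrow> real" where
  "dpp_value q r \<phi> \<epsilon> 0 m \<xi> \<eta> = \<phi> \<xi> \<eta>"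
| "dpp_value q r \<phi> \<epsilon> (Suc n) m \<xi> \<eta> =
     (INF f\<in>{-1..1}. MAX b\<in>{-1, 1}.
        dpp_value q r \<phi> \<epsilon> n (next_state b)
          (\<xi> + \<epsilon> * b * (q m - r m)) (\<eta> + \<epsilon> * b * (q m + r m - 2 * f)))"

text \<open>Meaningful only when \<open>(T - t) / \<epsilon>\<^sup>2\<close> is a nonnegative integer.\<close>

definition u_eps ::
  "(nat \<Rightarrow> real) \<Rightarrow> (nat \<Rightarrow> real) \<Rightarrow> (real \<Rightarrow> real \<Rightarrow> real) \<Rightarrow> real \<Rightarrow> real
    \<Rightarrow> real \<Rightarrow> nat \<Rightarrow> real \<Rightarrow> real \<Rightarrow> real" where
  "u_eps q r \<phi> T \<epsilon> t = dpp_value q r \<phi> \<epsilon> (nat \<lfloor>(T - t) / \<epsilon>\<^sup>2\<rfloor>)"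

definition C1_sharp :: "(nat \<Rightarrow> real) \<Rightarrow> (nat \<Rightarrow> real) \<Rightarrow> real" where
  "C1_sharp q r = ((q 1 - r 1)\<^sup>2 + (q 0 - r 0)\<^sup>2) / 2"

definition d_t :: "(real \<Rightarrow> real \<Rightarrow> real \<Rightarrow> real) \<Rightarrow> real \<Rightarrow> real \<Rightarrow> real \<Rightarrow> real" where
  "d_t g t \<xi> \<eta> = deriv (\<lambda>s. g s \<xi> \<eta>) t"

definition d_xi :: "(real \<Rightarrow> real \<Rightarrow> real \<Rightarrow> real) \<Rightarrow> real \<Rightarrow> real \<Rightarrow> real \<Rightarrow> real" where
  "d_xi g t \<xi> \<eta> = deriv (\<lambda>s. g t s \<eta>) \<xi>"

definition d_eta :: "(real \<Rightarrow> real \<Rightarrow> real \<Rightarrow> real) \<Rightarrow> real \<Rightarrow> real \<Rightarrow> real \<Rightarrow> real" where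
  "d_eta g t \<xi> \<eta> = deriv (\<lambda>s. g t \<xi> s) \<eta>"

definition diff_t_before :: "real \<Rightarrow> (real \<Rightarrow> real \<Rightarrow> real \<Rightarrow> real) \<Rightarrow> bool" where
  "diff_t_before T g \<longleftrightarrow> (\<forall>t<T. \<forall>\<xi> \<eta>. (\<lambda>s. g s \<xi> \<eta>) differentiable (at t))"

definition diff_space_before :: "real \<Rightarrow> (real \<Rightarrow> real \<Rightarrow> real \<Rightarrow> real) \<Rightarrow> bool" where
  "diff_space_before T g \<longleftrightarrow>
     (\<forall>t<T. \<forall>\<xi> \<eta>. (\<lambda>s. g t s \<eta>) differentiable (at \<xi>) \<and> (\<lambda>s. g t \<xi> s) differentiable (at \<eta>))"

definition cont_bdd_before :: "real \<Rightarrow> real \<Rightarrow> (real \<Rightarrow> real \<Rightarrow> real \<Rightarrow> real) \<Rightarrow> bool" where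
  "cont_bdd_before T K g \<longleftrightarrow>
     continuous_on ({..<T} \<times> UNIV \<times> UNIV) (\<lambda>(t, \<xi>, \<eta>). g t \<xi> \<eta>) \<and>
     (\<forall>t<T. \<forall>\<xi> \<eta>. \<bar>g t \<xi> \<eta>\<bar> \<le> K)"

text \<open>
  \<open>Ck_bdd T K k g\<close>: \<open>g\<close> and all its iterated partial derivatives in \<open>(\<xi>, \<eta>)\<close> of order at most \<open>k\<close>
  (in any order of differentiation) exist, are jointly continuous and are bounded by \<open>K\<close> on
  \<open>t < T\<close>. The bound does not degenerate as \<open>t\<close> increases to \<open>T\<close>.
\<close>

primrec Ck_bdd :: "real \<Rightarrow> real \<Rightarrow> nat \<Rightarrow> (real \<Rightarrow> real \<Rightarrow> real \<Rightarrow> real) \<Rightarrow> bool" where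
  "Ck_bdd T K 0 g \<longleftrightarrow> cont_bdd_before T K g"
| "Ck_bdd T K (Suc k) g \<longleftrightarrow>
     cont_bdd_before T K g \<and> diff_space_before T g \<and>
     Ck_bdd T K k (d_xi g) \<and> Ck_bdd T K k (d_eta g)"

text \<open>
  Regularity with all bounds equal to \<open>K\<close>. The function \<open>u\<close> itself is not required to be bounded
  (this would contradict \<open>d_eta u > c > 0\<close>): only its spatial derivatives of orders \<open>1\<close> to \<open>4\<close>
  are.
\<close>

definition regular_solution :: "real \<Rightarrow> real \<Rightarrow> (real \<Rightarrow> real \<Rightarrow> real \<Rightarrow> real) \<Rightarrow> bool" where
  "regular_solution T K u \<longleftrightarrow>
     continuous_on ({..<T} \<times> UNIV \<times> UNIV) (\<lambda>(t, \<xi>, \<eta>). u t \<xi> \<eta>) \<and>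
     diff_space_before T u \<and> Ck_bdd T K 3 (d_xi u) \<and> Ck_bdd T K 3 (d_eta u) \<and>
     diff_t_before T u \<and> Ck_bdd T K 2 (d_t u) \<and>
     diff_t_before T (d_t u) \<and> cont_bdd_before T K (d_t (d_t u))"

definition perp_grad :: "(real \<Rightarrow> real \<Rightarrow> real \<Rightarrow> real) \<Rightarrow> real \<Rightarrow> real \<Rightarrow> real \<Rightarrow> real ^ 2" where
  "perp_grad u t \<xi> \<eta> = vector [- d_eta u t \<xi> \<eta>, d_xi u t \<xi> \<eta>]"

definition hessian :: "(real \<Rightarrow> real \<Rightarrow> real \<Rightarrow> real) \<Rightarrow> real \<Rightarrow> real \<Rightarrow> real \<Rightarrow> real ^ 2 ^ 2" where
  "hessian u t \<xi> \<eta> =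
     vector [vector [d_xi (d_xi u) t \<xi> \<eta>, d_xi (d_eta u) t \<xi> \<eta>],
             vector [d_eta (d_xi u) t \<xi> \<eta>, d_eta (d_eta u) t \<xi> \<eta>]]"

text \<open>
  Classical solution of the final-value problem. The derivatives are those of \<open>deriv\<close>, so the
  equation has its intended meaning only in conjunction with \<open>regular_solution\<close>. Continuity up to
  \<open>t = T\<close> ties the final data to the solution at earlier times.
\<close>

definition solves_final_value_problem ::
  "real \<Rightarrow> real \<Rightarrow> (real \<Rightarrow> real \<Rightarrow> real) \<Rightarrow> (real \<Rightarrow> real \<Rightarrow> real \<Rightarrow> real) \<Rightarrow> bool" where
  "solves_final_value_problem T C \<phi> u \<longleftrightarrow>
     continuous_on ({..T} \<times> UNIV \<times> UNIV) (\<lambda>(t, \<xi>, \<eta>). u t \<xi> \<eta>) \<and>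
     (\<forall>\<xi> \<eta>. u T \<xi> \<eta> = \<phi> \<xi> \<eta>) \<and>
     (\<forall>t<T. \<forall>\<xi> \<eta>.
        let v = (1 / d_eta u t \<xi> \<eta>) *\<^sub>R perp_grad u t \<xi> \<eta>
        in d_t u t \<xi> \<eta> + 1 / 2 * C * ((hessian u t \<xi> \<eta> *v v) \<bullet> v) = 0)"


text \<open>Check that \<open>u_eps\<close> satisfies the dynamic programming principle with an attained minimum.\<close>

lemma compact_INF_attained:
  fixes h :: "'b::topological_space \<Rightarrow> real"
  assumes "compact S" "S \<noteq> {}" "continuous_on S h"
  obtains s where "s \<in> S" "\<And>s'. s' \<in> S \<Longrightarrow> h s \<le> h s'" "(INF s\<in>S. h s) = h s"
proof -
  obtain s where s: "s \<in> S" "\<And>s'. s' \<in> S \<Longrightarrow> h s \<le> h s'"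
    using continuous_attains_inf[OF assms] by blast
  have "(INF s\<in>S. h s) = h s"
    by (rule cInf_eq_minimum) (use s in auto)
  with s show thesis using that by blast
qed

lemma continuous_on_INF_compact:
  fixes g :: "'a::heine_borel \<Rightarrow> 'b::metric_space \<Rightarrow> real"
  assumes S: "compact S" "S \<noteq> {}"
    and g: "continuous_on (UNIV \<times> S) (\<lambda>(x, s). g x s)"
  shows "continuous_on UNIV (\<lambda>x. INF s\<in>S. g x s)"
proof -
  have gx: "continuous_on S (g x)" for x
  proof -
    have "continuous_on S ((\<lambda>(x, s). g x s) \<circ> (\<lambda>s. (x, s)))"
      by (intro continuous_on_compose continuous_intros continuous_on_subset[OF g]) auto
    then show ?thesis by (simp add: o_def)
  qed
  show ?thesis
    unfolding continuous_on_iff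
  proof (intro ballI allI impI)
    fix x0 :: 'a and e :: real assume e: "e > 0"
    have "compact (cball x0 1 \<times> S)" using S by (intro compact_Times) auto
    then have "uniformly_continuous_on (cball x0 1 \<times> S) (\<lambda>(x, s). g x s)"
      by (rule compact_uniformly_continuous[rotated])
         (auto intro: continuous_on_subset[OF g])
    then obtain d where d: "d > 0"
      "\<And>p p'. p \<in> cball x0 1 \<times> S \<Longrightarrow> p' \<in> cball x0 1 \<times> S \<Longrightarrow> dist p' p < d
         \<Longrightarrow> dist ((\<lambda>(x, s). g x s) p') ((\<lambda>(x, s). g x s) p) < e"
      unfolding uniformly_continuous_on_def using e by metis
    show "\<exists>d>0. \<forall>x\<in>UNIV. dist x x0 < d \<longrightarrow> dist (INF s\<in>S. g x s) (INF s\<in>S. g x0 s) < e"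
    proof (intro exI[of _ "min d 1"] conjI ballI impI)
      show "min d 1 > 0" using d by simp
      fix x assume x: "dist x x0 < min d 1"
      have close: "\<bar>g x s - g x0 s\<bar> < e" if "s \<in> S" for s
        using d(2)[of "(x0, s)" "(x, s)"] x that
        by (simp add: dist_Pair_Pair dist_real_def dist_commute)
      obtain s1 where s1: "s1 \<in> S" "\<And>s'. s' \<in> S \<Longrightarrow> g x s1 \<le> g x s'" "(INF s\<in>S. g x s) = g x s1"
        using compact_INF_attained[OF S gx] by metis
      obtain s2 where s2: "s2 \<in> S" "\<And>s'. s' \<in> S \<Longrightarrow> g x0 s2 \<le> g x0 s'" "(INF s\<in>S. g x0 s) = g x0 s2"
        using compact_INF_attained[OF S gx] by metis
      show "dist (INF s\<in>S. g x s) (INF s\<in>S. g x0 s) < e"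
        using close[OF s1(1)] close[OF s2(1)] s1(2)[OF s2(1)] s2(2)[OF s1(1)]
        by (simp add: s1(3) s2(3) dist_real_def)
    qed
  qed
qed

lemma dpp_step_continuous:
  fixes U :: "nat \<Rightarrow> real \<Rightarrow> real \<Rightarrow> real"
  assumes U: "\<And>m. continuous_on UNIV (\<lambda>(\<xi>, \<eta>). U m \<xi> \<eta>)"
  shows "continuous_on UNIV (\<lambda>((\<xi>, \<eta>), f). MAX b\<in>{-1, 1}.
           U (next_state b) (\<xi> + \<epsilon> * b * d) (\<eta> + \<epsilon> * b * (s - 2 * f)))"
proof -
  have "continuous_on UNIV
          ((\<lambda>(\<xi>, \<eta>). U m \<xi> \<eta>) \<circ> (\<lambda>p. (fst (fst p) + \<epsilon> * b * d, snd (fst p) + \<epsilon> * b * (s - 2 * snd p))))"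
    for m and b :: real
    by (intro continuous_on_compose continuous_intros continuous_on_subset[OF U]) auto
  then have "continuous_on UNIV
      (\<lambda>p. U m (fst (fst p) + \<epsilon> * b * d) (snd (fst p) + \<epsilon> * b * (s - 2 * snd p)))"
    for m and b :: real
    by (simp add: o_def)
  then have "continuous_on UNIV (\<lambda>p. max
      (U (next_state (-1)) (fst (fst p) + \<epsilon> * (-1) * d) (snd (fst p) + \<epsilon> * (-1) * (s - 2 * snd p)))
      (U (next_state 1) (fst (fst p) + \<epsilon> * 1 * d) (snd (fst p) + \<epsilon> * 1 * (s - 2 * snd p))))"
    by (intro continuous_on_max)
  moreover have "(MAX b\<in>{-1, 1}. F b) = max (F (-1)) (F 1)" for F :: "real \<Rightarrow> real"
    by simp
  ultimately show ?thesis
    by (simp only: case_prod_unfold)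
qed

lemma dpp_value_continuous:
  assumes "continuous_on UNIV (\<lambda>(\<xi>, \<eta>). \<phi> \<xi> \<eta>)"
  shows "continuous_on UNIV (\<lambda>(\<xi>, \<eta>). dpp_value q r \<phi> \<epsilon> n m \<xi> \<eta>)"
proof (induction n arbitrary: m)
  case 0
  then show ?case using assms by simp
next
  case (Suc n)
  have "continuous_on UNIV (\<lambda>x. INF f\<in>{-1..1}. case x of (\<xi>, \<eta>) \<Rightarrow> MAX b\<in>{-1, 1}.
        dpp_value q r \<phi> \<epsilon> n (next_state b)
          (\<xi> + \<epsilon> * b * (q m - r m)) (\<eta> + \<epsilon> * b * (q m + r m - 2 * f)))"
  proof (rule continuous_on_INF_compact)
    show "continuous_on (UNIV \<times> {-1..1}) (\<lambda>(x, f). case x of (\<xi>, \<eta>) \<Rightarrow> MAX b\<in>{-1, 1}.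
        dpp_value q r \<phi> \<epsilon> n (next_state b)
          (\<xi> + \<epsilon> * b * (q m - r m)) (\<eta> + \<epsilon> * b * (q m + r m - 2 * f)))"
      using continuous_on_subset[OF dpp_step_continuous[OF Suc] subset_UNIV]
      by (simp only: case_prod_unfold)
  qed auto
  then show ?case by (simp only: dpp_value.simps case_prod_unfold)
qed

lemma u_eps_final: "u_eps q r \<phi> T \<epsilon> T m \<xi> \<eta> = \<phi> \<xi> \<eta>"
  by (simp add: u_eps_def)

lemma u_eps_dpp:
  fixes q r :: "nat \<Rightarrow> real" and \<phi> :: "real \<Rightarrow> real \<Rightarrow> real" and T \<epsilon> t \<xi> \<eta> :: real and m :: nat
  defines "h \<equiv> \<lambda>f. MAX b\<in>{-1, 1}. u_eps q r \<phi> T \<epsilon> (t + \<epsilon>\<^sup>2) (next_state b)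
                   (\<xi> + \<epsilon> * b * (q m - r m)) (\<eta> + \<epsilon> * b * (q m + r m - 2 * f))"
  assumes \<phi>: "continuous_on UNIV (\<lambda>(\<xi>, \<eta>). \<phi> \<xi> \<eta>)"
    and "\<epsilon> > 0" "t < T" "(T - t) / \<epsilon>\<^sup>2 \<in> \<int>"
  shows "\<exists>f\<in>{-1..1}. u_eps q r \<phi> T \<epsilon> t m \<xi> \<eta> = h f \<and> (\<forall>f'\<in>{-1..1}. h f \<le> h f')"
proof -
  obtain k where k: "(T - t) / \<epsilon>\<^sup>2 = of_int k" using assms by (auto elim: Ints_cases)
  have "(T - t) / \<epsilon>\<^sup>2 > 0" using assms by simp
  then have "k > 0" using k by simp
  then obtain n where n: "k = int (Suc n)" by (metis gr0_implies_Suc pos_int_cases)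
  have "(T - (t + \<epsilon>\<^sup>2)) / \<epsilon>\<^sup>2 = of_int k - 1"
    using \<open>\<epsilon> > 0\<close> k by (simp add: field_simps)
  then have n': "(T - (t + \<epsilon>\<^sup>2)) / \<epsilon>\<^sup>2 = of_int (int n)" using n by simp
  have n0: "nat \<lfloor>(T - t) / \<epsilon>\<^sup>2\<rfloor> = Suc n" "nat \<lfloor>(T - (t + \<epsilon>\<^sup>2)) / \<epsilon>\<^sup>2\<rfloor> = n"
    unfolding k n n' by (simp_all only: floor_of_int nat_int)
  have h: "h = (\<lambda>f. MAX b\<in>{-1, 1}. dpp_value q r \<phi> \<epsilon> n (next_state b)
                   (\<xi> + \<epsilon> * b * (q m - r m)) (\<eta> + \<epsilon> * b * (q m + r m - 2 * f)))"
    unfolding h_def u_eps_def n0 ..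
  have "continuous_on {-1..1} ((\<lambda>((\<xi>, \<eta>), f). MAX b\<in>{-1, 1}. dpp_value q r \<phi> \<epsilon> n (next_state b)
           (\<xi> + \<epsilon> * b * (q m - r m)) (\<eta> + \<epsilon> * b * (q m + r m - 2 * f))) \<circ> (\<lambda>f. ((\<xi>, \<eta>), f)))"
    by (intro continuous_on_compose continuous_intros
          continuous_on_subset[OF dpp_step_continuous[OF dpp_value_continuous[OF \<phi>]]]) auto
  then have "continuous_on {-1..1} h" unfolding h by (simp only: o_def prod.case)
  then obtain f where f: "f \<in> {-1..1}" "\<And>f'. f' \<in> {-1..1} \<Longrightarrow> h f \<le> h f'" "(INF f\<in>{-1..1}. h f) = h f"
    using compact_INF_attained[of "{-1..1}" h] by (metis compact_Icc atLeastatMost_empty_iff neg_le_iff_le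
        le_minus_one_simps(1) order.trans zero_le_one)
  have "u_eps q r \<phi> T \<epsilon> t m \<xi> \<eta> = (INF f\<in>{-1..1}. h f)"
    unfolding u_eps_def n0 dpp_value.simps h ..
  then show ?thesis using f by auto
qed

end

theory Submission
  imports Defs
begin

text \<open>
  The proof builds a subsolution of the dynamic programming principle. Write \<open>d\<close> for
  \<open>q m - r m\<close>, \<open>w\<close> for \<open>q m + r m - 2 f\<close> and \<open>\<lambda> = d u\<^sub>\<xi> + w u\<^sub>\<eta>\<close>. Playing \<open>b\<close> moves the
  position by \<open>\<epsilon> b (d, w)\<close>, so a Taylor expansion of \<open>u\<close> reads
  \<open>u + \<epsilon> b \<lambda> + \<epsilon>\<^sup>2 (u\<^sub>t + 1/2 D\<^sup>2u[(d, w), (d, w)]) + O(\<epsilon>\<^sup>3)\<close>. If \<open>\<bar>\<lambda>\<bar>\<close> is much larger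
  than \<open>\<epsilon>\<close>, the choice \<open>b = sgn \<lambda>\<close> gains more than every other term can lose. If
  \<open>\<lambda> = O(\<epsilon>)\<close>, then \<open>(d, w)\<close> is tangent to the level curve of \<open>u\<close> up to \<open>O(\<epsilon>)\<close>, and the
  second-order term becomes \<open>u\<^sub>t + 1/2 d\<^sup>2 G\<close>, where \<open>G\<close> is the quadratic expression in the
  partial differential equation.

  That equation has the average \<open>C\<^sub>1\<^sup>#\<close> of \<open>d\<^sup>2\<close> over the two states in place of \<open>d\<^sup>2\<close>, so
  \<open>u\<^sub>t + 1/2 d\<^sup>2 G\<close> does not vanish: it is \<open>+p\<close> in state \<open>1\<close> and \<open>-p\<close> in state \<open>0\<close>, with
  \<open>p = 1/4 ((q 1 - r 1)\<^sup>2 - (q 0 - r 0)\<^sup>2) G\<close>. The function \<open>u + \<epsilon>\<^sup>2 (\<plusminus> p)\<close> absorbs this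
  oscillation. When \<open>\<lambda> = O(\<epsilon>)\<close> the maximum over \<open>b\<close> is bounded below by the average over
  \<open>b = \<plusminus>1\<close>. In that average the first-order terms cancel, and so do the correctors of the two
  successor states, up to \<open>\<epsilon>\<^sup>2\<close> times the increment of \<open>p\<close> over a distance \<open>O(\<epsilon>)\<close>. Hence every
  step loses at most \<open>O(\<epsilon>\<^sup>3)\<close> (lemma \<open>one_step\<close>). The \<open>(T - t) / \<epsilon>\<^sup>2\<close> steps lose
  \<open>O((T - t) \<epsilon>)\<close> (lemma \<open>dpp_lower_bound\<close>), and discarding the corrector at the initial time
  costs a further \<open>O(\<epsilon>\<^sup>2)\<close>.
\<close>

section \<open>Functions with bounded partial derivatives\<close>

lemma Ck_bdd_cont_bdd: "Ck_bdd T K k g \<Longrightarrow> cont_bdd_before T K g"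
  by (cases k) auto

lemma Ck_bdd_mono: "Ck_bdd T K k g \<Longrightarrow> j \<le> k \<Longrightarrow> Ck_bdd T K j g"
proof (induction k arbitrary: j g)
  case (Suc k)
  then show ?case by (cases j) auto
qed simp

lemma cont_bdd_before_bound: "cont_bdd_before T K g \<Longrightarrow> t < T \<Longrightarrow> \<bar>g t \<xi> \<eta>\<bar> \<le> K"
  by (simp add: cont_bdd_before_def)

lemma cont_bdd_before_slice:
  assumes "cont_bdd_before T K g" "t < T"
  shows "continuous_on UNIV (\<lambda>(\<xi>, \<eta>). g t \<xi> \<eta>)"
proof -
  have "continuous_on UNIV ((\<lambda>(t, \<xi>, \<eta>). g t \<xi> \<eta>) \<circ> (\<lambda>p. (t, fst p, snd p)))"
    using assms unfolding cont_bdd_before_def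
    by (intro continuous_on_compose continuous_intros)
       (auto elim!: continuous_on_subset)
  then show ?thesis by (simp add: o_def case_prod_unfold)
qed

lemma partial_derivatives:
  assumes "diff_space_before T g" "t < T"
  shows "((\<lambda>s. g t s \<eta>) has_real_derivative d_xi g t \<xi> \<eta>) (at \<xi>)"
    and "((\<lambda>s. g t \<xi> s) has_real_derivative d_eta g t \<xi> \<eta>) (at \<eta>)"
  using assms unfolding diff_space_before_def d_xi_def d_eta_def
  by (simp_all add: DERIV_deriv_iff_real_differentiable)

lemma lipschitz_of_bounded_derivative:
  fixes f f' :: "real \<Rightarrow> real"
  assumes "\<And>x. (f has_real_derivative f' x) (at x)" "\<And>x. \<bar>f' x\<bar> \<le> K"
  shows "\<bar>f y - f x\<bar> \<le> K * \<bar>y - x\<bar>"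
  using field_differentiable_bound[of UNIV f f' K y x] assms by simp

lemma Ck_bdd_lipschitz:
  assumes "Ck_bdd T K 1 g" "t < T"
  shows "\<bar>g t \<xi>' \<eta>' - g t \<xi> \<eta>\<bar> \<le> K * (\<bar>\<xi>' - \<xi>\<bar> + \<bar>\<eta>' - \<eta>\<bar>)"
proof -
  have ds: "diff_space_before T g" and
    b: "cont_bdd_before T K (d_xi g)" "cont_bdd_before T K (d_eta g)"
    using assms(1) by auto
  have "\<bar>g t \<xi>' \<eta>' - g t \<xi> \<eta>'\<bar> \<le> K * \<bar>\<xi>' - \<xi>\<bar>"
    by (rule lipschitz_of_bounded_derivative[OF partial_derivatives(1)[OF ds assms(2)]])
       (rule cont_bdd_before_bound[OF b(1) assms(2)])
  moreover have "\<bar>g t \<xi> \<eta>' - g t \<xi> \<eta>\<bar> \<le> K * \<bar>\<eta>' - \<eta>\<bar>"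
    by (rule lipschitz_of_bounded_derivative[OF partial_derivatives(2)[OF ds assms(2)]])
       (rule cont_bdd_before_bound[OF b(2) assms(2)])
  ultimately show ?thesis by (simp add: distrib_left)
qed

text \<open>
  The chain rule needs total differentiability, which holds because both partial derivatives exist
  everywhere and one of them is continuous.
\<close>

lemma derivative_along_line:
  assumes ds: "diff_space_before T g" and ce: "cont_bdd_before T K (d_eta g)" and t: "t < T"
  shows "((\<lambda>s. g t (\<xi> + s * a) (\<eta> + s * b)) has_real_derivative
     a * d_xi g t (\<xi> + s * a) (\<eta> + s * b) + b * d_eta g t (\<xi> + s * a) (\<eta> + s * b)) (at s)"
proof -
  let ?x = "\<xi> + s * a" and ?y = "\<eta> + s * b"
  have *: "((\<lambda>(x, y). g t x y) has_derivative
      (\<lambda>(dx, dy). dx * d_xi g t ?x ?y + blinfun_scaleR_left (d_eta g t ?x ?y) dy))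
      (at (?x, ?y) within UNIV \<times> UNIV)"
  proof (rule has_derivative_partialsI)
    show "((\<lambda>x. g t x ?y) has_derivative (\<lambda>dx. dx * d_xi g t ?x ?y)) (at ?x within UNIV)"
      using partial_derivatives(1)[OF ds t] by (simp add: has_field_derivative_def mult_commute_abs)
    show "((\<lambda>y. g t x y) has_derivative blinfun_scaleR_left (d_eta g t x y)) (at y within UNIV)" for x y
      using partial_derivatives(2)[OF ds t] by (simp add: has_field_derivative_def mult_commute_abs)
    have "continuous_on UNIV (\<lambda>p. blinfun_scaleR_left (case p of (x, y) \<Rightarrow> d_eta g t x y))"
      by (intro bounded_linear.continuous_on[OF bounded_linear_blinfun_scaleR_left]
          cont_bdd_before_slice[OF ce t])
    then show "continuous (at (?x, ?y) within UNIV \<times> UNIV)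
        (\<lambda>(x, y). blinfun_scaleR_left (d_eta g t x y))"
      by (simp add: continuous_on_eq_continuous_within case_prod_unfold)
  qed auto
  have "((\<lambda>s. (\<xi> + s * a, \<eta> + s * b)) has_derivative (\<lambda>h. (h * a, h * b))) (at s)"
    by (auto intro!: derivative_eq_intros)
  from has_derivative_compose[OF this *[unfolded UNIV_Times_UNIV]]
  have "((\<lambda>s. g t (\<xi> + s * a) (\<eta> + s * b)) has_derivative
      (\<lambda>h. h * a * d_xi g t ?x ?y + h * b * d_eta g t ?x ?y)) (at s)"
    by (simp add: mult.assoc)
  then show ?thesis
    by (simp add: has_field_derivative_def) (erule has_derivative_eq_rhs, auto simp: algebra_simps)
qed

section \<open>Quadratic forms\<close>

lemma quadratic_form_bound:
  fixes a b X Y Z :: real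
  assumes "\<bar>a\<bar> \<le> \<alpha>" "\<bar>b\<bar> \<le> \<beta>" "\<bar>X\<bar> \<le> x" "\<bar>Y\<bar> \<le> y" "\<bar>Z\<bar> \<le> z"
  shows "\<bar>a\<^sup>2 * X + a * b * Y + b\<^sup>2 * Z\<bar> \<le> \<alpha>\<^sup>2 * x + \<alpha> * \<beta> * y + \<beta>\<^sup>2 * z"
proof -
  have "\<bar>a\<^sup>2 * X\<bar> \<le> \<alpha>\<^sup>2 * x" "\<bar>a * b * Y\<bar> \<le> \<alpha> * \<beta> * y" "\<bar>b\<^sup>2 * Z\<bar> \<le> \<beta>\<^sup>2 * z"
    unfolding abs_mult power2_eq_square
    by (intro mult_mono assms mult_nonneg_nonneg order_trans[OF abs_ge_zero assms(1)]
        order_trans[OF abs_ge_zero assms(2)] abs_ge_zero)+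
  then show ?thesis by linarith
qed

lemma product_difference_bound:
  fixes x y x' y' :: real
  assumes "\<bar>x - x'\<bar> \<le> dx" "\<bar>y - y'\<bar> \<le> dy" "\<bar>y\<bar> \<le> Y" "\<bar>x'\<bar> \<le> X"
  shows "\<bar>x * y - x' * y'\<bar> \<le> dx * Y + X * dy"
proof -
  have "\<bar>(x - x') * y\<bar> \<le> dx * Y" "\<bar>x' * (y - y')\<bar> \<le> X * dy"
    unfolding abs_mult
    by (intro mult_mono assms order_trans[OF abs_ge_zero assms(1)] 
        order_trans[OF abs_ge_zero assms(4)] abs_ge_zero)+
  moreover have "x * y - x' * y' = (x - x') * y + x' * (y - y')" by (simp add: algebra_simps)
  ultimately show ?thesis by linarith
qed

text \<open>
  The coefficient of \<open>a b\<close> is the sum of the two mixed derivatives because both the second derivative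
  along a line and the matrix form of the Hessian produce this sum.
\<close>

definition hessian_form ::
  "(real \<Rightarrow> real \<Rightarrow> real \<Rightarrow> real) \<Rightarrow> real \<Rightarrow> real \<Rightarrow> real \<Rightarrow> real \<Rightarrow> real \<Rightarrow> real" where
  "hessian_form u t \<xi> \<eta> a b = a\<^sup>2 * d_xi (d_xi u) t \<xi> \<eta>
     + a * b * (d_xi (d_eta u) t \<xi> \<eta> + d_eta (d_xi u) t \<xi> \<eta>) + b\<^sup>2 * d_eta (d_eta u) t \<xi> \<eta>"

definition slope :: "(real \<Rightarrow> real \<Rightarrow> real \<Rightarrow> real) \<Rightarrow> real \<Rightarrow> real \<Rightarrow> real \<Rightarrow> real" where
  "slope u t \<xi> \<eta> = d_xi u t \<xi> \<eta> / d_eta u t \<xi> \<eta>"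

text \<open>
  The direction \<open>(1, - u\<^sub>\<xi> / u\<^sub>\<eta>)\<close> is \<open>- \<nabla>\<^sup>\<bottom> u / u\<^sub>\<eta>\<close>, so this is the quadratic expression
  of the partial differential equation.
\<close>

definition tangential_form :: "(real \<Rightarrow> real \<Rightarrow> real \<Rightarrow> real) \<Rightarrow> real \<Rightarrow> real \<Rightarrow> real \<Rightarrow> real" where
  "tangential_form u t \<xi> \<eta> = hessian_form u t \<xi> \<eta> 1 (- slope u t \<xi> \<eta>)"

lemma hessian_perp_grad:
  assumes "d_eta u t \<xi> \<eta> \<noteq> 0"
  defines "v \<equiv> (1 / d_eta u t \<xi> \<eta>) *\<^sub>R perp_grad u t \<xi> \<eta>"
  shows "(hessian u t \<xi> \<eta> *v v) \<bullet> v = tangential_form u t \<xi> \<eta>"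
proof -
  have v: "v $ 1 = - 1" "v $ 2 = slope u t \<xi> \<eta>"
    using assms(1) by (simp_all add: v_def perp_grad_def slope_def)
  have "(hessian u t \<xi> \<eta> *v v) \<bullet> v = hessian_form u t \<xi> \<eta> (v $ 1) (v $ 2)"
    unfolding hessian_form_def
    by (simp add: inner_vec_def sum_2 matrix_vector_mult_def hessian_def power2_eq_square algebra_simps)
  then show ?thesis
    unfolding v tangential_form_def by (simp add: hessian_form_def)
qed

text \<open>
  Before \<open>T\<close> this is the value of \<open>u\<^sub>t + 1/2 (q m - r m)\<^sup>2 G\<close> in state \<open>m = 1\<close>, where \<open>G\<close> is
  \<open>tangential_form\<close>; the value in state \<open>m = 0\<close> is its negative. The derivatives of \<open>u\<close> are controlled only before \<open>T\<close>. The value zero from \<open>T\<close>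
  on makes the subsolution agree with the final data exactly, and it keeps \<open>p\<close> bounded and, at
  each fixed time, Lipschitz in space. The jump in time at \<open>T\<close> does no harm, because one step of the
  game compares values of \<open>p\<close> at the same later time only.
\<close>

definition corrector ::
  "(nat \<Rightarrow> real) \<Rightarrow> (nat \<Rightarrow> real) \<Rightarrow> real \<Rightarrow> (real \<Rightarrow> real \<Rightarrow> real \<Rightarrow> real)
     \<Rightarrow> real \<Rightarrow> real \<Rightarrow> real \<Rightarrow> real" where
  "corrector q r T u t \<xi> \<eta> =
     (if t < T then ((q 1 - r 1)\<^sup>2 - (q 0 - r 0)\<^sup>2) / 4 * tangential_form u t \<xi> \<eta> else 0)"

text \<open>The inverse of \<open>next_state\<close>: the move that leads to a given state.\<close>

definition state_sign :: "nat \<Rightarrow> real" where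
  "state_sign m = (if m = 1 then 1 else - 1)"

text \<open>
  The loss of one step in units of \<open>\<epsilon>\<^sup>3\<close>. It is the sum of \<open>115 K\<close> from the Taylor expansion in
  space (\<open>108 K\<close>) and time (\<open>7 K\<close>), of \<open>6 (4 K + 8 K\<^sup>2 / c)\<close> from the variation of the corrector,
  and of \<open>40 K\<^sup>2 / c\<close> from the deviation of the displacement from the tangent direction.
\<close>

definition step_constant :: "real \<Rightarrow> real \<Rightarrow> real" where
  "step_constant c K = 139 * K + 88 * K\<^sup>2 / c"

locale prediction_solution =
  fixes q r :: "nat \<Rightarrow> real" and c K T :: real
    and \<phi> :: "real \<Rightarrow> real \<Rightarrow> real" and u :: "real \<Rightarrow> real \<Rightarrow> real \<Rightarrow> real"
  assumes q_less_1: "\<forall>m\<in>{0, 1}. \<bar>q m\<bar> < 1" and r_less_1: "\<forall>m\<in>{0, 1}. \<bar>r m\<bar> < 1"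
    and c_pos: "c > 0"
    and solves: "solves_final_value_problem T (C1_sharp q r) \<phi> u"
    and regular: "regular_solution T K u"
    and eta_lower: "\<forall>t<T. \<forall>\<xi> \<eta>. d_eta u t \<xi> \<eta> > c"
    and grad_cone: "\<forall>t<T. \<forall>\<xi> \<eta>. \<bar>d_xi u t \<xi> \<eta>\<bar> \<le> d_eta u t \<xi> \<eta>"
begin

abbreviation "p \<equiv> corrector q r T u"

lemma regularity_bounds:
  shows "diff_space_before T u" "diff_t_before T u" "diff_t_before T (d_t u)"
    and "cont_bdd_before T K (d_t (d_t u))" "Ck_bdd T K 1 (d_t u)"
    and "Ck_bdd T K 1 (d_xi u)" "Ck_bdd T K 1 (d_eta u)"
    and "Ck_bdd T K 1 (d_xi (d_xi u))" "Ck_bdd T K 1 (d_xi (d_eta u))"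
    and "Ck_bdd T K 1 (d_eta (d_xi u))" "Ck_bdd T K 1 (d_eta (d_eta u))"
proof -
  have *: "Ck_bdd T K 3 (d_xi u)" "Ck_bdd T K 3 (d_eta u)" "Ck_bdd T K 2 (d_t u)"
    using regular by (simp_all only: regular_solution_def)
  then have "Ck_bdd T K (Suc 2) (d_xi u)" "Ck_bdd T K (Suc 2) (d_eta u)"
    by (simp_all only: numeral_3_eq_3 numeral_2_eq_2)
  then show "Ck_bdd T K 1 (d_xi (d_xi u))" "Ck_bdd T K 1 (d_xi (d_eta u))"
    "Ck_bdd T K 1 (d_eta (d_xi u))" "Ck_bdd T K 1 (d_eta (d_eta u))"
    unfolding Ck_bdd.simps by (auto intro: Ck_bdd_mono simp del: Ck_bdd.simps)
  show "Ck_bdd T K 1 (d_t u)" "Ck_bdd T K 1 (d_xi u)" "Ck_bdd T K 1 (d_eta u)"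
    by (rule Ck_bdd_mono[OF *(3)] Ck_bdd_mono[OF *(1)] Ck_bdd_mono[OF *(2)], simp)+
qed (use regular in \<open>simp_all only: regular_solution_def\<close>)

lemma K_nonneg: "K \<ge> 0"
  using cont_bdd_before_bound[OF regularity_bounds(4), of "T - 1" 0 0] by linarith

lemma slope_bound: "t < T \<Longrightarrow> \<bar>slope u t \<xi> \<eta>\<bar> \<le> 1"
proof -
  assume "t < T"
  then have "\<bar>d_xi u t \<xi> \<eta>\<bar> \<le> d_eta u t \<xi> \<eta>" "d_eta u t \<xi> \<eta> > c"
    using grad_cone eta_lower by auto
  then show ?thesis using c_pos by (simp add: slope_def)
qed

text \<open>Here the lower bound on \<open>u\<^sub>\<eta>\<close> is what keeps the quotient under control.\<close>

lemma slope_lipschitz: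
  assumes "t < T"
  shows "\<bar>slope u t \<xi>' \<eta>' - slope u t \<xi> \<eta>\<bar> \<le> 2 * K / c * (\<bar>\<xi>' - \<xi>\<bar> + \<bar>\<eta>' - \<eta>\<bar>)"
proof -
  define x where "x = d_xi u t \<xi> \<eta>"
  define x' where "x' = d_xi u t \<xi>' \<eta>'"
  define e where "e = d_eta u t \<xi> \<eta>"
  define e' where "e' = d_eta u t \<xi>' \<eta>'"
  define d where "d = K * (\<bar>\<xi>' - \<xi>\<bar> + \<bar>\<eta>' - \<eta>\<bar>)"
  have d: "\<bar>x' - x\<bar> \<le> d" "\<bar>e' - e\<bar> \<le> d"
    unfolding x_def x'_def e_def e'_def d_def
    by (rule Ck_bdd_lipschitz[OF regularity_bounds(6) assms]
        Ck_bdd_lipschitz[OF regularity_bounds(7) assms])+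
  have e: "e > c" "e' > c" using eta_lower assms by (auto simp: e_def e'_def)
  have rho: "\<bar>x / e\<bar> \<le> 1"
    using slope_bound[OF assms] by (simp add: slope_def x_def e_def)
  define z where "z = x / e * (e' - e)"
  have eq: "x' / e' - x / e = ((x' - x) - z) / e'"
    using e c_pos by (simp add: z_def field_simps)
  have "\<bar>z\<bar> \<le> 1 * d"
    unfolding z_def abs_mult[of "x / e"] by (intro mult_mono rho d) auto
  then have "\<bar>(x' - x) - z\<bar> \<le> 2 * d" using d by linarith
  then have "\<bar>x' / e' - x / e\<bar> \<le> 2 * d / c"
    unfolding eq abs_divide using e c_pos by (intro frac_le) auto
  then show ?thesis
    by (simp add: slope_def x_def x'_def e_def e'_def d_def)
qed

lemma second_derivative_bounds:
  assumes "t < T"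
  shows "\<bar>d_xi (d_xi u) t \<xi> \<eta>\<bar> \<le> K"
    and "\<bar>d_xi (d_eta u) t \<xi> \<eta> + d_eta (d_xi u) t \<xi> \<eta>\<bar> \<le> 2 * K"
    and "\<bar>d_eta (d_eta u) t \<xi> \<eta>\<bar> \<le> K"
  using regularity_bounds(8-11)[THEN Ck_bdd_cont_bdd, THEN cont_bdd_before_bound, OF assms, of \<xi> \<eta>]
  by linarith+

lemma second_derivative_lipschitz:
  fixes t \<xi> \<eta> \<xi>' \<eta>' :: real
  assumes "t < T"
  defines "d \<equiv> K * (\<bar>\<xi>' - \<xi>\<bar> + \<bar>\<eta>' - \<eta>\<bar>)"
  shows "\<bar>d_xi (d_xi u) t \<xi>' \<eta>' - d_xi (d_xi u) t \<xi> \<eta>\<bar> \<le> d"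
    and "\<bar>(d_xi (d_eta u) t \<xi>' \<eta>' + d_eta (d_xi u) t \<xi>' \<eta>')
           - (d_xi (d_eta u) t \<xi> \<eta> + d_eta (d_xi u) t \<xi> \<eta>)\<bar> \<le> 2 * d"
    and "\<bar>d_eta (d_eta u) t \<xi>' \<eta>' - d_eta (d_eta u) t \<xi> \<eta>\<bar> \<le> d"
  using regularity_bounds(8-11)[THEN Ck_bdd_lipschitz, OF assms(1), of \<xi>' \<eta>' \<xi> \<eta>]
  unfolding d_def by linarith+

lemma tangential_form_bound:
  assumes "t < T" shows "\<bar>tangential_form u t \<xi> \<eta>\<bar> \<le> 4 * K"
proof -
  have "\<bar>tangential_form u t \<xi> \<eta>\<bar> \<le> 1\<^sup>2 * K + 1 * 1 * (2 * K) + 1\<^sup>2 * K"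
    unfolding tangential_form_def hessian_form_def
    by (intro quadratic_form_bound second_derivative_bounds assms)
       (simp_all add: slope_bound[OF assms])
  then show ?thesis by simp
qed

lemma tangential_form_lipschitz:
  assumes "t < T"
  shows "\<bar>tangential_form u t \<xi>' \<eta>' - tangential_form u t \<xi> \<eta>\<bar>
    \<le> (4 * K + 8 * K\<^sup>2 / c) * (\<bar>\<xi>' - \<xi>\<bar> + \<bar>\<eta>' - \<eta>\<bar>)"
proof -
  define \<rho> where "\<rho> = slope u t \<xi> \<eta>"
  define \<rho>' where "\<rho>' = slope u t \<xi>' \<eta>'"
  define d where "d = \<bar>\<xi>' - \<xi>\<bar> + \<bar>\<eta>' - \<eta>\<bar>"
  note lip = second_derivative_lipschitz[OF assms, of \<xi>' \<eta>' \<xi> \<eta>, folded d_def]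
  note bd = second_derivative_bounds[OF assms]
  have r: "\<bar>\<rho>\<bar> \<le> 1" "\<bar>\<rho>'\<bar> \<le> 1" "\<bar>\<rho>' - \<rho>\<bar> \<le> 2 * K / c * d"
    unfolding \<rho>_def \<rho>'_def d_def by (intro slope_bound slope_lipschitz assms)+
  have r2: "\<bar>\<rho>' * \<rho>' - \<rho> * \<rho>\<bar> \<le> 2 * K / c * d * 1 + 1 * (2 * K / c * d)"
    by (intro product_difference_bound r)
  have r2b: "\<bar>\<rho> * \<rho>\<bar> \<le> 1 * 1" unfolding abs_mult by (intro mult_mono r) auto
  note t2 = product_difference_bound[OF r(3) lip(2) bd(2) r(1)]
  note t3 = product_difference_bound[OF r2 lip(3) bd(3) r2b]
  have "\<bar>tangential_form u t \<xi>' \<eta>' - tangential_form u t \<xi> \<eta>\<bar> \<le> K * d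
     + (2 * K / c * d * (2 * K) + 1 * (2 * (K * d)))
     + ((2 * K / c * d * 1 + 1 * (2 * K / c * d)) * K + 1 * 1 * (K * d))"
    using lip(1) t2 t3
    unfolding tangential_form_def hessian_form_def \<rho>_def[symmetric] \<rho>'_def[symmetric]
      power2_eq_square mult_minus_right mult_minus_left mult_1_left mult_1_right minus_minus
    by linarith
  also have "\<dots> = (4 * K + 8 * K\<^sup>2 / c) * d"
    by (simp add: field_simps power2_eq_square)
  finally show ?thesis unfolding d_def .
qed

lemma expert_bounds:
  assumes "m \<in> {0, 1}"
  shows "\<bar>q m - r m\<bar> \<le> 2" and "f \<in> {-1..1} \<Longrightarrow> \<bar>q m + r m - 2 * f\<bar> \<le> 4"
  using q_less_1 r_less_1 assms by fastforce+

lemma corrector_coefficient_bound: "\<bar>((q 1 - r 1)\<^sup>2 - (q 0 - r 0)\<^sup>2) / 4\<bar> \<le> 1"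
proof -
  have "(q m - r m)\<^sup>2 \<le> 2\<^sup>2" if "m \<in> {0, 1}" for m
    using expert_bounds(1)[OF that] by (intro abs_le_square_iff[THEN iffD1]) simp
  moreover have "\<bar>(x - y) / 4\<bar> \<le> 1" if "0 \<le> x" "0 \<le> y" "x \<le> 2\<^sup>2" "y \<le> 2\<^sup>2" for x y :: real
    using that by (simp add: abs_le_iff)
  ultimately show ?thesis by simp
qed

lemma corrector_bound: "\<bar>p t \<xi> \<eta>\<bar> \<le> 4 * K"
proof (cases "t < T")
  case True
  then have "\<bar>p t \<xi> \<eta>\<bar> \<le> 1 * (4 * K)"
    unfolding corrector_def if_P[OF True] abs_mult
    by (intro mult_mono corrector_coefficient_bound tangential_form_bound) auto
  then show ?thesis by simp
qed (use K_nonneg in \<open>simp add: corrector_def\<close>)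

lemma corrector_lipschitz:
  "\<bar>p t \<xi>' \<eta>' - p t \<xi> \<eta>\<bar> \<le> (4 * K + 8 * K\<^sup>2 / c) * (\<bar>\<xi>' - \<xi>\<bar> + \<bar>\<eta>' - \<eta>\<bar>)"
proof (cases "t < T")
  case True
  then have "\<bar>p t \<xi>' \<eta>' - p t \<xi> \<eta>\<bar>
      \<le> 1 * ((4 * K + 8 * K\<^sup>2 / c) * (\<bar>\<xi>' - \<xi>\<bar> + \<bar>\<eta>' - \<eta>\<bar>))"
    unfolding corrector_def if_P[OF True] right_diff_distrib[symmetric] abs_mult
    by (intro mult_mono corrector_coefficient_bound tangential_form_lipschitz) auto
  then show ?thesis by simp
qed (use K_nonneg c_pos in \<open>simp add: corrector_def\<close>)

text \<open>
  This is the partial differential equation, rewritten with the weight \<open>(q m - r m)\<^sup>2\<close> of the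
  current state: the average \<open>C\<^sub>1\<^sup>#\<close> differs from the two weights by opposite amounts.
\<close>

lemma corrector_equation:
  assumes "t < T" "m \<in> {0, 1}"
  shows "d_t u t \<xi> \<eta> + (q m - r m)\<^sup>2 / 2 * tangential_form u t \<xi> \<eta> = state_sign m * p t \<xi> \<eta>"
proof -
  have "d_eta u t \<xi> \<eta> > c" using eta_lower assms by auto
  then have "d_eta u t \<xi> \<eta> \<noteq> 0" using c_pos by simp
  note tangential = hessian_perp_grad[OF this]
  have "d_t u t \<xi> \<eta> + 1 / 2 * C1_sharp q r *
    ((hessian u t \<xi> \<eta> *v ((1 / d_eta u t \<xi> \<eta>) *\<^sub>R perp_grad u t \<xi> \<eta>))
       \<bullet> ((1 / d_eta u t \<xi> \<eta>) *\<^sub>R perp_grad u t \<xi> \<eta>)) = 0"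
    using solves assms(1) unfolding solves_final_value_problem_def Let_def by blast
  then have "d_t u t \<xi> \<eta> = - (1 / 2 * C1_sharp q r * tangential_form u t \<xi> \<eta>)"
    unfolding tangential by linarith
  then show ?thesis
    using assms by (auto simp: corrector_def state_sign_def C1_sharp_def field_simps)
qed

section \<open>One step of the game\<close>

text \<open>
  Second-order expansion with the remainder estimated by the Lipschitz continuity of the second
  derivatives along the segment, whose points are within \<open>6 \<epsilon>\<close> of the base point.
\<close>

lemma space_taylor:
  assumes t: "t < T" and \<epsilon>: "0 < \<epsilon>" and ab: "\<bar>a\<bar> \<le> 2" "\<bar>b\<bar> \<le> 4"
  shows "u t (\<xi> + \<epsilon> * a) (\<eta> + \<epsilon> * b) \<ge> u t \<xi> \<eta>
     + \<epsilon> * (a * d_xi u t \<xi> \<eta> + b * d_eta u t \<xi> \<eta>)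
     + \<epsilon>\<^sup>2 / 2 * hessian_form u t \<xi> \<eta> a b - 108 * K * \<epsilon> ^ 3"
proof -
  let ?X = "\<lambda>s. \<xi> + s * a" and ?Y = "\<lambda>s. \<eta> + s * b"
  \<comment> \<open>\<open>h i\<close> is the \<open>i\<close>-th derivative, for \<open>i \<le> 2\<close>, of the restriction of \<open>u\<close> to the segment.\<close>
  define h where "h i s = (if i = 0 then u t (?X s) (?Y s)
     else if i = 1 then a * d_xi u t (?X s) (?Y s) + b * d_eta u t (?X s) (?Y s)
     else hessian_form u t (?X s) (?Y s) a b)" for i :: nat and s
  have c1: "cont_bdd_before T K (d_eta u)" "cont_bdd_before T K (d_eta (d_xi u))"
      "cont_bdd_before T K (d_eta (d_eta u))"
    "diff_space_before T (d_xi u)" "diff_space_before T (d_eta u)"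
    using regularity_bounds(6,7,10,11) by auto
  have "DERIV (h 0) s :> h 1 s" for s
    unfolding h_def using derivative_along_line[OF regularity_bounds(1) c1(1) t] by simp
  moreover have "DERIV (h 1) s :> h 2 s" for s
    unfolding h_def hessian_form_def
    by (auto intro!: derivative_eq_intros derivative_along_line[OF c1(4) c1(2) t]
        derivative_along_line[OF c1(5) c1(3) t] simp: power2_eq_square algebra_simps)
  ultimately have "\<forall>i s. i < 2 \<and> 0 \<le> s \<and> s \<le> \<epsilon> \<longrightarrow> DERIV (h i) s :> h (Suc i) s"
    by (auto simp: numeral_2_eq_2 less_Suc_eq)
  from Maclaurin2[OF \<epsilon> refl this] obtain s where s: "0 < s" "s \<le> \<epsilon>"
    "h 0 \<epsilon> = (\<Sum>i<2. h i 0 / fact i * \<epsilon> ^ i) + h 2 s / fact 2 * \<epsilon>\<^sup>2" by auto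
  define d where "d = K * (\<bar>?X s - \<xi>\<bar> + \<bar>?Y s - \<eta>\<bar>)"
  have "\<bar>s * a\<bar> \<le> \<epsilon> * 2" "\<bar>s * b\<bar> \<le> \<epsilon> * 4"
    unfolding abs_mult using s ab by (intro mult_mono; simp)+
  then have "\<bar>?X s - \<xi>\<bar> + \<bar>?Y s - \<eta>\<bar> \<le> 6 * \<epsilon>" by simp
  then have d: "d \<le> K * (6 * \<epsilon>)"
    unfolding d_def using K_nonneg by (intro mult_left_mono)
  have "\<bar>h 2 s - h 2 0\<bar> \<le> 2\<^sup>2 * d + 2 * 4 * (2 * d) + 4\<^sup>2 * d"
    using quadratic_form_bound[OF ab second_derivative_lipschitz[OF t, of "?X s" "?Y s" \<xi> \<eta>]]
    unfolding d_def[symmetric]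
    by (simp add: h_def hessian_form_def algebra_simps)
  with d have "h 2 s \<ge> h 2 0 - 216 * K * \<epsilon>" by simp
  then have "h 2 s / 2 * \<epsilon>\<^sup>2 \<ge> (h 2 0 - 216 * K * \<epsilon>) / 2 * \<epsilon>\<^sup>2"
    by (intro mult_right_mono divide_right_mono) auto
  then show ?thesis
    using s(3) by (simp add: h_def numeral_2_eq_2 power3_eq_cube power2_eq_square algebra_simps)
qed

text \<open>
  The mean value theorem allows the step to end exactly at \<open>T\<close>, where \<open>u\<close> is only known to be
  continuous: the intermediate time lies strictly before \<open>T\<close>.
\<close>

lemma time_increment:
  assumes t: "t < T" and \<epsilon>: "0 < \<epsilon>" "\<epsilon> \<le> 1" and tT: "t + \<epsilon>\<^sup>2 \<le> T"
    and near: "\<bar>\<xi>' - \<xi>\<bar> + \<bar>\<eta>' - \<eta>\<bar> \<le> 6 * \<epsilon>"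
  shows "u (t + \<epsilon>\<^sup>2) \<xi>' \<eta>' \<ge> u t \<xi>' \<eta>' + \<epsilon>\<^sup>2 * d_t u t \<xi> \<eta> - 7 * K * \<epsilon> ^ 3"
proof -
  have ut: "((\<lambda>s. u s \<xi>' \<eta>') has_real_derivative d_t u s \<xi>' \<eta>') (at s)"
    and utt: "((\<lambda>s. d_t u s \<xi>' \<eta>') has_real_derivative d_t (d_t u) s \<xi>' \<eta>') (at s)" if "s < T" for s
    using regularity_bounds(2,3) that unfolding diff_t_before_def d_t_def
    by (simp_all add: DERIV_deriv_iff_real_differentiable)
  have "continuous_on {..T} ((\<lambda>(t, \<xi>, \<eta>). u t \<xi> \<eta>) \<circ> (\<lambda>s. (s, \<xi>', \<eta>')))"
    using solves unfolding solves_final_value_problem_def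
    by (intro continuous_on_compose continuous_intros) (auto elim!: continuous_on_subset)
  then have "continuous_on {t..t + \<epsilon>\<^sup>2} (\<lambda>s. u s \<xi>' \<eta>')"
    using tT by (auto simp: o_def elim!: continuous_on_subset)
  moreover have "((\<lambda>s. u s \<xi>' \<eta>') has_derivative (\<lambda>x. d_t u s \<xi>' \<eta>' * x)) (at s)"
    if "t < s" "s < t + \<epsilon>\<^sup>2" for s
    using ut[of s] that tT by (simp add: has_field_derivative_def)
  moreover have "t < t + \<epsilon>\<^sup>2" using \<epsilon> by simp
  ultimately obtain s where s: "t < s" "s < t + \<epsilon>\<^sup>2"
    "u (t + \<epsilon>\<^sup>2) \<xi>' \<eta>' - u t \<xi>' \<eta>' = d_t u s \<xi>' \<eta>' * (t + \<epsilon>\<^sup>2 - t)"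
    using mvt[of t "t + \<epsilon>\<^sup>2" "\<lambda>s. u s \<xi>' \<eta>'" "\<lambda>s x. d_t u s \<xi>' \<eta>' * x"] by auto
  have sT: "s < T" using s tT by simp
  have "\<bar>d_t u s \<xi>' \<eta>' - d_t u t \<xi>' \<eta>'\<bar> \<le> K * \<bar>s - t\<bar>"
    using field_differentiable_bound[of "{t..s}" "\<lambda>s. d_t u s \<xi>' \<eta>'"
        "\<lambda>s. d_t (d_t u) s \<xi>' \<eta>'" K s t]
      utt[THEN has_field_derivative_at_within] sT s(1)
      cont_bdd_before_bound[OF regularity_bounds(4)] by force
  also have "\<dots> \<le> K * \<epsilon>" 
  proof (rule mult_left_mono[OF _ K_nonneg])
    have "\<epsilon>\<^sup>2 \<le> \<epsilon>" using \<epsilon> mult_left_le[of \<epsilon> \<epsilon>] by (simp add: power2_eq_square)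
    then show "\<bar>s - t\<bar> \<le> \<epsilon>" using s by linarith
  qed
  finally have 1: "\<bar>d_t u s \<xi>' \<eta>' - d_t u t \<xi>' \<eta>'\<bar> \<le> K * \<epsilon>" .
  have "\<bar>d_t u t \<xi>' \<eta>' - d_t u t \<xi> \<eta>\<bar> \<le> K * (\<bar>\<xi>' - \<xi>\<bar> + \<bar>\<eta>' - \<eta>\<bar>)"
    by (rule Ck_bdd_lipschitz[OF regularity_bounds(5) t])
  also have "\<dots> \<le> K * (6 * \<epsilon>)" using near K_nonneg by (intro mult_left_mono)
  finally have "d_t u s \<xi>' \<eta>' \<ge> d_t u t \<xi> \<eta> - 7 * K * \<epsilon>" using 1 by linarith
  then have "d_t u s \<xi>' \<eta>' * \<epsilon>\<^sup>2 \<ge> (d_t u t \<xi> \<eta> - 7 * K * \<epsilon>) * \<epsilon>\<^sup>2"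
    by (intro mult_right_mono) auto
  then show ?thesis
    using s(3) by (simp add: power3_eq_cube power2_eq_square algebra_simps)
qed

text \<open>
  The distance of \<open>(a, b)\<close> from the multiple \<open>a (1, - u\<^sub>\<xi> / u\<^sub>\<eta>)\<close> of the tangent vector is
  \<open>\<bar>a u\<^sub>\<xi> + b u\<^sub>\<eta>\<bar> / u\<^sub>\<eta>\<close>, and the difference of the two values of the quadratic form has this
  distance as a factor.
\<close>

lemma hessian_form_near_tangent:
  assumes t: "t < T" and ab: "\<bar>a\<bar> \<le> 2" "\<bar>b\<bar> \<le> 4"
  shows "hessian_form u t \<xi> \<eta> a b \<ge> a\<^sup>2 * tangential_form u t \<xi> \<eta>
     - 10 * K / c * \<bar>a * d_xi u t \<xi> \<eta> + b * d_eta u t \<xi> \<eta>\<bar>"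
proof -
  define \<rho> where "\<rho> = slope u t \<xi> \<eta>"
  define l where "l = a * d_xi u t \<xi> \<eta> + b * d_eta u t \<xi> \<eta>"
  define B where "B = d_xi (d_eta u) t \<xi> \<eta> + d_eta (d_xi u) t \<xi> \<eta>"
  define C where "C = d_eta (d_eta u) t \<xi> \<eta>"
  have e: "d_eta u t \<xi> \<eta> > c" using eta_lower t by auto
  have off: "b + a * \<rho> = l / d_eta u t \<xi> \<eta>"
    using e c_pos by (simp add: l_def \<rho>_def slope_def field_simps)
  have "\<bar>b + a * \<rho>\<bar> \<le> \<bar>l\<bar> / c"
    unfolding off abs_divide using e c_pos by (intro frac_le) auto
  moreover have "\<bar>a * B + (b - a * \<rho>) * C\<bar> \<le> 10 * K"
  proof -
    have "\<bar>a * \<rho>\<bar> \<le> 2 * 1"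
      unfolding abs_mult \<rho>_def by (intro mult_mono ab slope_bound t) auto
    then have "\<bar>b - a * \<rho>\<bar> \<le> 6" using ab by linarith
    then have "\<bar>(b - a * \<rho>) * C\<bar> \<le> 6 * K"
      unfolding abs_mult C_def by (intro mult_mono second_derivative_bounds t) auto
    moreover have "\<bar>a * B\<bar> \<le> 2 * (2 * K)"
      unfolding abs_mult B_def by (intro mult_mono second_derivative_bounds t ab) auto
    ultimately show ?thesis by linarith
  qed
  ultimately have "\<bar>(b + a * \<rho>) * (a * B + (b - a * \<rho>) * C)\<bar> \<le> \<bar>l\<bar> / c * (10 * K)"
    unfolding abs_mult using c_pos by (intro mult_mono) auto
  moreover have "hessian_form u t \<xi> \<eta> a b - a\<^sup>2 * tangential_form u t \<xi> \<eta>
      = (b + a * \<rho>) * (a * B + (b - a * \<rho>) * C)"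
    unfolding tangential_form_def hessian_form_def \<rho>_def[symmetric] B_def[symmetric] C_def[symmetric]
    by (simp add: power2_eq_square algebra_simps)
  ultimately show ?thesis by (simp add: l_def mult.commute)
qed

text \<open>
  The market can answer every \<open>f\<close> so well that the corrected function loses only \<open>O(\<epsilon>\<^sup>3)\<close>. The
  second summand on the left is the corrector of the successor state, whose sign is \<open>b\<close>. The
  threshold \<open>8 K \<epsilon>\<close> for \<open>\<bar>l\<bar>\<close> is twice \<open>\<epsilon>\<close> times the bound \<open>4 K\<close> on \<open>p\<close>: above it, half of the
  gain \<open>\<epsilon> \<bar>l\<bar>\<close> pays for the corrector and the other half for the deviation from the tangent, by
  the smallness of \<open>\<epsilon>\<close>.
\<close>

lemma one_step:
  fixes \<epsilon> f :: real
  assumes t: "t < T" "t + \<epsilon>\<^sup>2 \<le> T" and \<epsilon>: "0 < \<epsilon>" "\<epsilon> \<le> 1" "5 * K / c * \<epsilon> \<le> 1 / 2"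
    and m: "m \<in> {0, 1}" and f: "f \<in> {-1..1}"
  shows "\<exists>b\<in>{-1, 1}. u (t + \<epsilon>\<^sup>2) (\<xi> + \<epsilon> * b * (q m - r m)) (\<eta> + \<epsilon> * b * (q m + r m - 2 * f))
        + \<epsilon>\<^sup>2 * b * p (t + \<epsilon>\<^sup>2) (\<xi> + \<epsilon> * b * (q m - r m)) (\<eta> + \<epsilon> * b * (q m + r m - 2 * f))
      \<ge> u t \<xi> \<eta> + \<epsilon>\<^sup>2 * (state_sign m * p t \<xi> \<eta>) - step_constant c K * \<epsilon> ^ 3"
proof -
  define a where "a = q m - r m"
  define w where "w = q m + r m - 2 * f"
  define l where "l = a * d_xi u t \<xi> \<eta> + w * d_eta u t \<xi> \<eta>"
  define P where "P b = p (t + \<epsilon>\<^sup>2) (\<xi> + \<epsilon> * b * a) (\<eta> + \<epsilon> * b * w)" for b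
  define X where "X b = u (t + \<epsilon>\<^sup>2) (\<xi> + \<epsilon> * b * a) (\<eta> + \<epsilon> * b * w) + \<epsilon>\<^sup>2 * b * P b" for b
  define Y where "Y = u t \<xi> \<eta> + \<epsilon>\<^sup>2 * (state_sign m * p t \<xi> \<eta>)"
  have aw: "\<bar>a\<bar> \<le> 2" "\<bar>w\<bar> \<le> 4" using expert_bounds[OF m] f by (auto simp: a_def w_def)
  define E where "E = 5 * K / c * \<epsilon>\<^sup>2 * \<bar>l\<bar>"
  have gain: "X b \<ge> Y + \<epsilon> * b * l + \<epsilon>\<^sup>2 * b * P b - E - 115 * K * \<epsilon> ^ 3"
    if b: "b \<in> {-1, 1}" for b
  proof -
    have bw: "\<bar>b * a\<bar> \<le> 2" "\<bar>b * w\<bar> \<le> 4" "b\<^sup>2 = 1" using aw b by auto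
    have h: "hessian_form u t \<xi> \<eta> (b * a) (b * w) = hessian_form u t \<xi> \<eta> a w"
      using b by (auto simp: hessian_form_def)
    have "\<bar>\<epsilon> * (b * a)\<bar> + \<bar>\<epsilon> * (b * w)\<bar> \<le> 6 * \<epsilon>"
      using bw \<epsilon>(1) mult_left_mono[of "\<bar>b * a\<bar> + \<bar>b * w\<bar>" 6 \<epsilon>]
      by (simp add: abs_mult[of \<epsilon>] distrib_left)
    then have "u (t + \<epsilon>\<^sup>2) (\<xi> + \<epsilon> * (b * a)) (\<eta> + \<epsilon> * (b * w))
        \<ge> u t (\<xi> + \<epsilon> * (b * a)) (\<eta> + \<epsilon> * (b * w)) + \<epsilon>\<^sup>2 * d_t u t \<xi> \<eta> - 7 * K * \<epsilon> ^ 3"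
      by (intro time_increment t \<epsilon>) simp
    moreover note space_taylor[OF t(1) \<epsilon>(1) bw(1,2), of \<xi> \<eta>]
    moreover have "\<epsilon>\<^sup>2 / 2 * hessian_form u t \<xi> \<eta> a w
        \<ge> \<epsilon>\<^sup>2 * (a\<^sup>2 / 2 * tangential_form u t \<xi> \<eta>) - E"
    proof -
      have "\<epsilon>\<^sup>2 / 2 * hessian_form u t \<xi> \<eta> a w
          \<ge> \<epsilon>\<^sup>2 / 2 * (a\<^sup>2 * tangential_form u t \<xi> \<eta> - 10 * K / c * \<bar>l\<bar>)"
        unfolding l_def by (intro mult_left_mono hessian_form_near_tangent t aw) auto
      also have "\<epsilon>\<^sup>2 / 2 * (a\<^sup>2 * tangential_form u t \<xi> \<eta> - 10 * K / c * \<bar>l\<bar>)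
          = \<epsilon>\<^sup>2 * (a\<^sup>2 / 2 * tangential_form u t \<xi> \<eta>) - E"
        using c_pos by (simp add: E_def field_simps)
      finally show ?thesis .
    qed
    moreover have "\<epsilon>\<^sup>2 * (d_t u t \<xi> \<eta> + a\<^sup>2 / 2 * tangential_form u t \<xi> \<eta>)
        = \<epsilon>\<^sup>2 * (state_sign m * p t \<xi> \<eta>)"
      unfolding a_def corrector_equation[OF t(1) m] ..
    moreover have "\<epsilon> * (b * a * d_xi u t \<xi> \<eta> + b * w * d_eta u t \<xi> \<eta>) = \<epsilon> * b * l"
      by (simp add: l_def algebra_simps)
    ultimately show ?thesis
      unfolding X_def Y_def h by (simp add: algebra_simps)
  qed
  have Pb: "\<bar>P b\<bar> \<le> 4 * K" for b unfolding P_def by (rule corrector_bound)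
  have "\<exists>b\<in>{-1, 1}. X b \<ge> Y - step_constant c K * \<epsilon> ^ 3"
  proof (cases "\<bar>l\<bar> \<le> 8 * K * \<epsilon>")
    case True
    \<comment> \<open>Averaging over both moves: the terms odd in \<open>b\<close> cancel, apart from \<open>P 1 - P (-1)\<close>.\<close>
    have "\<bar>P 1 - P (-1)\<bar> \<le> (4 * K + 8 * K\<^sup>2 / c) * (\<bar>2 * (\<epsilon> * a)\<bar> + \<bar>2 * (\<epsilon> * w)\<bar>)"
      using corrector_lipschitz[of "t + \<epsilon>\<^sup>2" "\<xi> + \<epsilon> * a" "\<eta> + \<epsilon> * w" "\<xi> - \<epsilon> * a" "\<eta> - \<epsilon> * w"]
      by (simp add: P_def)
    also have "\<dots> \<le> (4 * K + 8 * K\<^sup>2 / c) * (12 * \<epsilon>)"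
    proof (rule mult_left_mono)
      have "\<bar>\<epsilon> * a\<bar> \<le> \<epsilon> * 2" "\<bar>\<epsilon> * w\<bar> \<le> \<epsilon> * 4"
        unfolding abs_mult using \<epsilon> aw by simp_all
      then show "\<bar>2 * (\<epsilon> * a)\<bar> + \<bar>2 * (\<epsilon> * w)\<bar> \<le> 12 * \<epsilon>" by simp
    qed (use K_nonneg c_pos in simp)
    finally have "P 1 - P (-1) \<ge> - ((4 * K + 8 * K\<^sup>2 / c) * (12 * \<epsilon>))" by linarith
    then have "\<epsilon>\<^sup>2 * (P 1 - P (-1)) \<ge> \<epsilon>\<^sup>2 * - ((4 * K + 8 * K\<^sup>2 / c) * (12 * \<epsilon>))"
      by (intro mult_left_mono) auto
    moreover have "E \<le> 5 * K / c * \<epsilon>\<^sup>2 * (8 * K * \<epsilon>)"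
      unfolding E_def using True K_nonneg c_pos by (intro mult_left_mono) auto
    ultimately have "X 1 + X (-1) \<ge> 2 * Y - \<epsilon>\<^sup>2 * ((4 * K + 8 * K\<^sup>2 / c) * (12 * \<epsilon>))
       - 2 * (5 * K / c * \<epsilon>\<^sup>2 * (8 * K * \<epsilon>)) - 2 * (115 * K * \<epsilon> ^ 3)"
      using gain[of 1] gain[of "-1"] by (simp add: right_diff_distrib)
    also have "2 * Y - \<epsilon>\<^sup>2 * ((4 * K + 8 * K\<^sup>2 / c) * (12 * \<epsilon>))
       - 2 * (5 * K / c * \<epsilon>\<^sup>2 * (8 * K * \<epsilon>)) - 2 * (115 * K * \<epsilon> ^ 3) = 2 * (Y - step_constant c K * \<epsilon> ^ 3)"
      by (simp add: step_constant_def field_simps power2_eq_square power3_eq_cube)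
    finally show ?thesis by force
  next
    case False
    \<comment> \<open>The first-order gain dominates for the move in the direction of \<open>l\<close>.\<close>
    define b where "b = (if l \<ge> 0 then 1 else - 1 :: real)"
    have b: "b \<in> {-1, 1}" "b * l = \<bar>l\<bar>" by (auto simp: b_def)
    have "b * P b \<ge> - (4 * K)" using Pb[of b] b(1) by auto
    then have "\<epsilon>\<^sup>2 * (b * P b) \<ge> \<epsilon>\<^sup>2 * - (4 * K)" by (intro mult_left_mono) auto
    moreover have "\<epsilon> * \<bar>l\<bar> * (5 * K / c * \<epsilon>) \<le> \<epsilon> * \<bar>l\<bar> * (1 / 2)"
      using \<epsilon> by (intro mult_left_mono) auto
    moreover have "E = \<epsilon> * \<bar>l\<bar> * (5 * K / c * \<epsilon>)" by (simp add: E_def power2_eq_square)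
    moreover have "\<epsilon>\<^sup>2 * - (4 * K) = - (\<epsilon> * (8 * K * \<epsilon>)) / 2" by (simp add: power2_eq_square)
    moreover have "\<epsilon> * (8 * K * \<epsilon>) \<le> \<epsilon> * \<bar>l\<bar>" using False \<epsilon>(1) by (intro mult_left_mono) auto
    ultimately have "\<epsilon> * \<bar>l\<bar> + \<epsilon>\<^sup>2 * (b * P b) - E \<ge> 0"
      by linarith
    then have "\<epsilon> * b * l + \<epsilon>\<^sup>2 * b * P b - E \<ge> 0"
      unfolding b(2)[symmetric] by (simp only: mult.assoc)
    then have "X b \<ge> Y - 115 * K * \<epsilon> ^ 3" using gain[OF b(1)] by linarith
    moreover have "115 * K * \<epsilon> ^ 3 \<le> step_constant c K * \<epsilon> ^ 3"
      unfolding step_constant_def using K_nonneg c_pos \<epsilon>(1) by (intro mult_right_mono) auto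
    ultimately show ?thesis using b(1) by force
  qed
  then show ?thesis unfolding X_def P_def Y_def a_def w_def .
qed

section \<open>The lower bound\<close>

lemma dpp_lower_bound:
  assumes \<epsilon>: "0 < \<epsilon>" "\<epsilon> \<le> 1" "5 * K / c * \<epsilon> \<le> 1 / 2" and m: "m \<in> {0, 1}"
  shows "dpp_value q r \<phi> \<epsilon> n m \<xi> \<eta> \<ge> u (T - real n * \<epsilon>\<^sup>2) \<xi> \<eta>
     + \<epsilon>\<^sup>2 * (state_sign m * p (T - real n * \<epsilon>\<^sup>2) \<xi> \<eta>) - real n * (step_constant c K * \<epsilon> ^ 3)"
  using m
proof (induction n arbitrary: m \<xi> \<eta>)
  case 0
  then show ?case using solves by (simp add: corrector_def solves_final_value_problem_def)
next
  case (Suc n)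
  define t where "t = T - real (Suc n) * \<epsilon>\<^sup>2"
  have t: "t + \<epsilon>\<^sup>2 = T - real n * \<epsilon>\<^sup>2" by (simp add: t_def algebra_simps)
  have tT: "t < T" "t + \<epsilon>\<^sup>2 \<le> T" using \<epsilon>(1) by (simp_all add: t_def)
  have "u t \<xi> \<eta> + \<epsilon>\<^sup>2 * (state_sign m * p t \<xi> \<eta>) - real (Suc n) * (step_constant c K * \<epsilon> ^ 3)
      \<le> dpp_value q r \<phi> \<epsilon> (Suc n) m \<xi> \<eta>" (is "?L \<le> _")
    unfolding dpp_value.simps
  proof (rule cINF_greatest)
    fix f :: real assume f: "f \<in> {-1..1}"
    let ?x = "\<lambda>b. \<xi> + \<epsilon> * b * (q m - r m)" and ?y = "\<lambda>b. \<eta> + \<epsilon> * b * (q m + r m - 2 * f)"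
    from one_step[OF tT \<epsilon> Suc.prems f, of \<xi> \<eta>]
    obtain b where b: "b \<in> {-1, 1}" and
      g: "u (t + \<epsilon>\<^sup>2) (?x b) (?y b) + \<epsilon>\<^sup>2 * b * p (t + \<epsilon>\<^sup>2) (?x b) (?y b)
        \<ge> u t \<xi> \<eta> + \<epsilon>\<^sup>2 * (state_sign m * p t \<xi> \<eta>) - step_constant c K * \<epsilon> ^ 3" by blast
    have "state_sign (next_state b) = b" "next_state b \<in> {0, 1}"
      using b by (auto simp: next_state_def state_sign_def)
    with Suc.IH[of "next_state b" "?x b" "?y b"] g
    have "?L \<le> dpp_value q r \<phi> \<epsilon> n (next_state b) (?x b) (?y b)"
      by (simp add: t algebra_simps)
    also have "\<dots> \<le> (MAX b\<in>{-1, 1}. dpp_value q r \<phi> \<epsilon> n (next_state b) (?x b) (?y b))"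
      using b by (intro Max_ge) auto
    finally show "?L \<le> \<dots>" .
  qed simp
  then show ?case by (simp only: t_def)
qed

lemma u_eps_lower_bound:
  assumes \<epsilon>: "0 < \<epsilon>" "\<epsilon> \<le> 1" "5 * K / c * \<epsilon> \<le> 1 / 2" and m: "m \<in> {0, 1}"
    and t: "t < T" "(T - t) / \<epsilon>\<^sup>2 \<in> \<int>"
  shows "u_eps q r \<phi> T \<epsilon> t m \<xi> \<eta> \<ge> u t \<xi> \<eta> - (step_constant c K + 4 * K) * ((T - t) + \<epsilon>) * \<epsilon>"
proof -
  define n where "n = nat \<lfloor>(T - t) / \<epsilon>\<^sup>2\<rfloor>"
  have "real n = (T - t) / \<epsilon>\<^sup>2"
    unfolding n_def using t by (auto elim!: Ints_cases)
  then have n: "real n * \<epsilon>\<^sup>2 = T - t" using \<epsilon>(1) by simp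
  have "\<bar>state_sign m * p t \<xi> \<eta>\<bar> \<le> 4 * K"
    using corrector_bound[of t \<xi> \<eta>] by (simp add: state_sign_def)
  then have "state_sign m * p t \<xi> \<eta> \<ge> - (4 * K)" by linarith
  then have P: "\<epsilon>\<^sup>2 * (state_sign m * p t \<xi> \<eta>) \<ge> \<epsilon>\<^sup>2 * - (4 * K)" by (intro mult_left_mono) auto
  have "real n * (step_constant c K * \<epsilon> ^ 3) = step_constant c K * (T - t) * \<epsilon>"
    unfolding n[symmetric] by (simp add: power2_eq_square power3_eq_cube)
  with dpp_lower_bound[OF \<epsilon> m, of n \<xi> \<eta>] P
  have "u_eps q r \<phi> T \<epsilon> t m \<xi> \<eta> \<ge> u t \<xi> \<eta> - 4 * K * \<epsilon>\<^sup>2 - step_constant c K * (T - t) * \<epsilon>"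
    unfolding u_eps_def n_def[symmetric] n by (simp add: mult.commute)
  moreover have "4 * K * \<epsilon>\<^sup>2 + step_constant c K * (T - t) * \<epsilon> \<le> (step_constant c K + 4 * K) * ((T - t) + \<epsilon>) * \<epsilon>"
  proof -
    have "step_constant c K * \<epsilon> * \<epsilon> \<ge> 0" "4 * K * (T - t) * \<epsilon> \<ge> 0"
      unfolding step_constant_def using K_nonneg c_pos \<epsilon> t by auto
    then show ?thesis by (simp add: power2_eq_square algebra_simps)
  qed
  ultimately show ?thesis by linarith
qed

end

theorem theorem3p2:
  fixes q r :: "nat \<Rightarrow> real" and c K :: real
  assumes "\<forall>m\<in>{0, 1}. \<bar>q m\<bar> < 1" and "\<forall>m\<in>{0, 1}. \<bar>r m\<bar> < 1"
    and "\<exists>m\<in>{0, 1}. q m \<noteq> r m"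
    and "c > 0"
  shows "\<exists>C. \<exists>\<epsilon>\<^sub>0>0. \<forall>(T::real) (\<phi> :: real \<Rightarrow> real \<Rightarrow> real) (u :: real \<Rightarrow> real \<Rightarrow> real \<Rightarrow> real).
           solves_final_value_problem T (C1_sharp q r) \<phi> u \<longrightarrow>
           regular_solution T K u \<longrightarrow>
           (\<forall>t<T. \<forall>\<xi> \<eta>. d_eta u t \<xi> \<eta> > c) \<longrightarrow>
           (\<forall>t<T. \<forall>\<xi> \<eta>. \<bar>d_xi u t \<xi> \<eta>\<bar> \<le> d_eta u t \<xi> \<eta>) \<longrightarrow>
           (\<forall>\<epsilon> t \<xi> \<eta>. \<forall>m\<in>{0, 1}.
              0 < \<epsilon> \<and> \<epsilon> < \<epsilon>\<^sub>0 \<and> t < T \<and> (T - t) / \<epsilon>\<^sup>2 \<in> \<int> \<longrightarrow>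
              u_eps q r \<phi> T \<epsilon> t m \<xi> \<eta> \<ge> u t \<xi> \<eta> - C * ((T - t) + \<epsilon>) * \<epsilon>)"
proof -
  \<comment> \<open>This makes \<open>\<epsilon> \<le> 1\<close> and \<open>5 K \<epsilon> / c \<le> 1/2\<close>. The absolute value keeps \<open>\<epsilon>\<^sub>0\<close> positive
    for negative \<open>K\<close>, where the hypotheses on \<open>u\<close> are contradictory.\<close>
  define \<epsilon>\<^sub>0 where "\<epsilon>\<^sub>0 = 1 / (1 + 10 * \<bar>K\<bar> / c)"
  have pos: "1 + 10 * \<bar>K\<bar> / c \<ge> 1" using assms(4) by simp
  have small: "\<epsilon> \<le> 1" "5 * K / c * \<epsilon> \<le> 1 / 2" if "0 < \<epsilon>" "\<epsilon> < \<epsilon>\<^sub>0" for \<epsilon>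
  proof -
    have *: "\<epsilon> * (1 + 10 * \<bar>K\<bar> / c) < 1"
      using that pos by (simp add: \<epsilon>\<^sub>0_def field_simps)
    have "\<epsilon> * (10 * \<bar>K\<bar> / c) \<ge> 0" using that assms(4) by simp
    with * show "\<epsilon> \<le> 1" unfolding distrib_left mult_1_right by linarith
    have "10 * K / c * \<epsilon> \<le> 10 * \<bar>K\<bar> / c * \<epsilon>"
      using that assms(4) by (intro mult_right_mono divide_right_mono) auto
    also have "\<dots> < 1" using * that unfolding distrib_left mult_1_right by (simp add: mult.commute)
    finally show "5 * K / c * \<epsilon> \<le> 1 / 2" by simp
  qed
  show ?thesis
  proof (rule exI[of _ "step_constant c K + 4 * K"], rule exI[of _ \<epsilon>\<^sub>0], intro conjI allI impI ballI)
    show "\<epsilon>\<^sub>0 > 0" using pos by (simp add: \<epsilon>\<^sub>0_def)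
    fix T \<phi> u \<epsilon> t \<xi> \<eta> and m :: nat
    assume A: "solves_final_value_problem T (C1_sharp q r) \<phi> u" "regular_solution T K u"
      "\<forall>t<T. \<forall>\<xi> \<eta>. d_eta u t \<xi> \<eta> > c"
      "\<forall>t<T. \<forall>\<xi> \<eta>. \<bar>d_xi u t \<xi> \<eta>\<bar> \<le> d_eta u t \<xi> \<eta>"
      and m: "m \<in> {0, 1}"
      and e: "0 < \<epsilon> \<and> \<epsilon> < \<epsilon>\<^sub>0 \<and> t < T \<and> (T - t) / \<epsilon>\<^sup>2 \<in> \<int>"
    interpret prediction_solution q r c K T \<phi> u
      using assms A by unfold_locales
    show "u_eps q r \<phi> T \<epsilon> t m \<xi> \<eta> \<ge>
        u t \<xi> \<eta> - (step_constant c K + 4 * K) * ((T - t) + \<epsilon>) * \<epsilon>"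
      using e m small by (intro u_eps_lower_bound) auto
  qed
qed

end
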